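(* Let $F$ be a field with $|F|>2$ and let $P_1,\dots,P_t$ be maximal parabolic subgroups of $\mathrm{GL}_3(F)$. Suppose that for every $i\in\{1,\dots,t\}$ we have $P_i\nsupseteq \bigcap_{j\neq i}P_j$. Then $t\leq 5$.
   Context: Here a maximal parabolic subgroup of $\mathrm{GL}_3(F)$ means, by definition, the stabilizer $\{g\in \mathrm{GL}_3(F) : g(V)=V\}$ of some subspace $V\subseteq F^3$ with $V\neq 0$ and $V\neq F^3$. An empty intersection of subgroups of $\mathrm{GL}_3(F)$ is understood as $\mathrm{GL}_3(F)$. *)

theory Defs
  imports "HOL-Analysis.Cartesian_Space"
begin

definition GL3 :: "('f::field ^ 3 ^ 3) set" where
  "GL3 = {g. invertible g}"

definition stabilizer3 :: "('f::field ^ 3) set \<Rightarrow> ('f ^ 3 ^ 3) set" where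
  "stabilizer3 V = {g \<in> GL3. (\<lambda>v. g *v v) ` V = V}"

definition maximal_parabolic :: "('f::field ^ 3 ^ 3) set \<Rightarrow> bool" where
  "maximal_parabolic P \<longleftrightarrow>
     (\<exists>V. vec.subspace V \<and> V \<noteq> {0} \<and> V \<noteq> UNIV \<and> P = stabilizer3 V)"

end

theory Submission
  imports Defs
begin

text \<open>
  A point of the projective plane is the span of a vector and a line is the kernel of a covector, so
  fixing either one means having a given vector as eigenvector of \<open>g\<close> or of its transpose.
  Suppose first that the points contain a basis \<open>a, b, c\<close>. A matrix fixing these has three
  eigenvalues, and it fixes any further point or line if and only if the eigenvalues agree on the
  support of its coordinates. Such conditions correspond to partitions of a three-element set, whose
  lattice has rank 2, so at most two further objects can be irredundant. Dually if the lines contain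
  a basis. Otherwise all points are collinear and all lines concurrent, and there are at most three
  of each, since fixing three collinear points means being scalar on their span. With three points
  and three lines, no line contains all three points (it would be redundant), so pairing each line
  with the points shows that its eigenvalue is the eigenvalue of the points; hence the first two
  lines have equal eigenvalues and the third is redundant.
\<close>

section \<open>The pairing of covectors with vectors\<close>

definition dot :: "'f::field ^ 'n \<Rightarrow> 'f ^ 'n \<Rightarrow> 'f" where
  "dot m v = (\<Sum>i\<in>UNIV. m $ i * v $ i)"

lemma dot_add_right: "dot m (v + w) = dot m v + dot m w"
  by (simp add: dot_def distrib_left sum.distrib)

lemma dot_scale_right: "dot m (c *s v) = c * dot m v"
  by (simp add: dot_def sum_distrib_left mult_ac)

lemma dot_diff_left: "dot (m - n) v = dot m v - dot n v"
  by (simp add: dot_def left_diff_distrib sum_subtractf)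

lemma dot_scale_left: "dot (c *s m) v = c * dot m v"
  by (simp add: dot_def sum_distrib_left mult_ac)

lemma dot_zero_left [simp]: "dot 0 v = 0"
  by (simp add: dot_def)

lemma dot_transpose: "dot (transpose g *v m) v = dot m (g *v v)"
proof -
  have "dot (transpose g *v m) v = (\<Sum>i\<in>UNIV. \<Sum>j\<in>UNIV. g $ j $ i * m $ j * v $ i)"
    by (simp add: dot_def matrix_vector_mult_def transpose_def sum_distrib_right)
  also have "\<dots> = (\<Sum>j\<in>UNIV. \<Sum>i\<in>UNIV. g $ j $ i * m $ j * v $ i)"
    by (rule sum.swap)
  also have "\<dots> = dot m (g *v v)"
    by (simp add: dot_def matrix_vector_mult_def sum_distrib_left mult_ac)
  finally show ?thesis .
qed

lemma dot_vector_matrix: "dot (m v* g) v = dot m (g *v v)"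
  using dot_transpose[of g m v] by simp

lemma dot_axis: "dot m (axis i 1) = m $ i"
  by (simp add: dot_def axis_def if_distrib cong: if_cong)

lemma dot_eq_0_on_span:
  assumes "\<And>v. v \<in> B \<Longrightarrow> dot m v = 0" and "v \<in> vec.span B"
  shows "dot m v = 0"
  using assms(2)
proof (induction rule: vec.span_induct_alt)
  case base
  then show ?case by (simp add: dot_def)
next
  case (step c x y)
  then show ?case using assms(1) by (simp add: dot_add_right dot_scale_right)
qed

text \<open>Evaluating at the standard basis vectors reads off the coordinates of
  \<open>m\<close>.\<close>

lemma eq_0_if_dot_eq_0_on_spanning:
  assumes "\<And>v. v \<in> B \<Longrightarrow> dot m v = 0" and "vec.span B = UNIV"
  shows "m = 0"
  using dot_eq_0_on_span[OF assms(1), where v = "axis _ 1"] assms(2)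
  by (simp add: dot_axis vec_eq_iff)

section \<open>Spans of two and three vectors, and bases of three-space\<close>

lemma span_pair:
  "x \<in> vec.span {a, b} \<longleftrightarrow> (\<exists>\<alpha> \<beta>. x = \<alpha> *s a + \<beta> *s b)" for a :: "'f::field ^ 'n"
proof -
  have "x \<in> vec.span {a, b} \<longleftrightarrow> (\<exists>\<alpha> \<beta>. x - \<alpha> *s a = \<beta> *s b)"
    by (auto simp: vec.span_insert vec.span_singleton)
  then show ?thesis by (simp add: diff_eq_eq add.commute)
qed

lemma span_triple:
  "x \<in> vec.span {a, b, c} \<longleftrightarrow> (\<exists>\<alpha> \<beta> \<gamma>. x = \<alpha> *s a + \<beta> *s b + \<gamma> *s c)" for a :: "'f::field ^ 'n"
proof -
  have "x \<in> vec.span {a, b, c} \<longleftrightarrow> (\<exists>\<alpha>. x - \<alpha> *s a \<in> vec.span {b, c})"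
    by (auto simp: vec.span_insert[of a])
  also have "\<dots> \<longleftrightarrow> (\<exists>\<alpha> \<beta> \<gamma>. x - \<alpha> *s a = \<beta> *s b + \<gamma> *s c)"
    by (simp add: span_pair)
  finally show ?thesis by (simp add: diff_eq_eq algebra_simps)
qed

lemma scale_in_span_iff: "c *s x \<in> vec.span B \<longleftrightarrow> c = 0 \<or> x \<in> vec.span B"
  for x :: "'f::field ^ 'n"
proof (cases "c = 0")
  case False
  then show ?thesis
    using vec.span_scale[of "c *s x" B "inverse c"] by (auto intro: vec.span_scale)
qed (simp add: vec.span_zero)

text \<open>Independence is put in stepwise form because it arises that way: non-coplanarity
  supplies \<open>c\<close>, non-parallelism \<open>b\<close>, nonvanishing \<open>a\<close>. The
  coefficients are eliminated from the last to the first.\<close>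

lemma linear_combination3_eq_0:
  fixes a b c :: "'f::field ^ 'n"
  assumes c: "c \<notin> vec.span {a, b}" and b: "b \<notin> vec.span {a}" and "a \<noteq> 0"
    and eq: "\<alpha> *s a + \<beta> *s b + \<gamma> *s c = 0"
  shows "\<alpha> = 0 \<and> \<beta> = 0 \<and> \<gamma> = 0"
proof -
  have "\<gamma> = 0"
  proof (rule ccontr)
    assume "\<gamma> \<noteq> 0"
    have "\<gamma> *s c = (- \<alpha>) *s a + (- \<beta>) *s b"
      using eq by (simp add: eq_neg_iff_add_eq_0 algebra_simps)
    then have "\<gamma> *s c \<in> vec.span {a, b}"
      unfolding span_pair by blast
    then show False
      using c \<open>\<gamma> \<noteq> 0\<close> by (simp add: scale_in_span_iff)
  qed
  moreover have "\<beta> = 0"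
  proof (rule ccontr)
    assume "\<beta> \<noteq> 0"
    have "\<beta> *s b = (- \<alpha>) *s a"
      using eq \<open>\<gamma> = 0\<close> by (simp add: eq_neg_iff_add_eq_0 algebra_simps)
    then have "\<beta> *s b \<in> vec.span {a}"
      unfolding vec.span_singleton by blast
    then show False
      using b \<open>\<beta> \<noteq> 0\<close> by (simp add: scale_in_span_iff)
  qed
  ultimately show ?thesis
    using eq \<open>a \<noteq> 0\<close> by simp
qed

lemma independent_triple:
  fixes a b c :: "'f::field ^ 'n"
  assumes "c \<notin> vec.span {a, b}" and "b \<notin> vec.span {a}" and "a \<noteq> 0"
  shows "vec.independent {c, b, a}"
proof (intro vec.independent_insertI)
  show "c \<notin> vec.span {b, a}" using assms(1) by (simp add: insert_commute)
qed (use assms in \<open>auto simp: vec.independent_empty\<close>)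

lemma span_triple_UNIV:
  fixes a b c :: "'f::field ^ 3"
  assumes "c \<notin> vec.span {a, b}" and "b \<notin> vec.span {a}" and "a \<noteq> 0"
  shows "vec.span {a, b, c} = UNIV"
proof -
  have "c \<noteq> a" "c \<noteq> b" "b \<noteq> a"
    using assms by (auto intro: vec.span_base)
  then have 3: "card {a, b, c} = 3" by auto
  have "vec.independent {c, b, a}"
    using assms by (rule independent_triple)
  then have "vec.independent {a, b, c}"
    by (simp add: insert_commute)
  then have "UNIV \<subseteq> vec.span {a, b, c}"
    by (intro vec.card_ge_dim_independent) (auto simp: 3 card_cart_basis)
  then show ?thesis by blast
qed

section \<open>Fixed points and fixed lines in an eigenbasis\<close>

definition has_eigenvector :: "'f::field ^ 'n ^ 'n \<Rightarrow> 'f ^ 'n \<Rightarrow> bool" where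
  "has_eigenvector g v \<longleftrightarrow> (\<exists>c. g *v v = c *s v)"

text \<open>
  The pair \<open>(True, v)\<close> encodes the point spanned by \<open>v\<close>, and \<open>(False, m)\<close> encodes the line
  \<open>{v. dot m v = 0}\<close>. Invertibility is not required here, so transposition is a duality without
  any inverses.
\<close>

definition fixes_subspace :: "'f::field ^ 'n ^ 'n \<Rightarrow> bool \<times> ('f ^ 'n) \<Rightarrow> bool" where
  "fixes_subspace g x \<longleftrightarrow> has_eigenvector (if fst x then g else transpose g) (snd x)"

lemma mult_combination2:
  fixes h :: "'f::field ^ 'n ^ 'n"
  assumes "h *v a = r *s a" and "h *v b = s *s b"
  shows "h *v (\<alpha> *s a + \<beta> *s b) = (\<alpha> * r) *s a + (\<beta> * s) *s b"
  using assms by (simp add: matrix_vector_right_distrib vector_scalar_commute vector_smult_assoc)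

lemma mult_combination3:
  fixes h :: "'f::field ^ 'n ^ 'n"
  assumes "h *v a = r *s a" and "h *v b = s *s b" and "h *v c = t *s c"
  shows "h *v (\<alpha> *s a + \<beta> *s b + \<gamma> *s c) = (\<alpha> * r) *s a + (\<beta> * s) *s b + (\<gamma> * t) *s c"
  using assms by (simp add: matrix_vector_right_distrib vector_scalar_commute vector_smult_assoc)

text \<open>A nonzero coordinate forces \<open>k\<close> to be its eigenvalue, and a zero coordinate
  imposes nothing. So a common \<open>k\<close> exists exactly when the eigenvalues agree on the
  support of the coordinates.\<close>

lemma common_eigenvalue_iff:
  fixes x y z :: "'f::field"
  shows "(\<exists>k. r * x = k * x \<and> s * y = k * y \<and> t * z = k * z) \<longleftrightarrow>
    (x \<noteq> 0 \<and> y \<noteq> 0 \<longrightarrow> r = s) \<and> (x \<noteq> 0 \<and> z \<noteq> 0 \<longrightarrow> r = t) \<and> (y \<noteq> 0 \<and> z \<noteq> 0 \<longrightarrow> s = t)"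
  by (cases "x = 0"; cases "y = 0"; cases "z = 0") auto

text \<open>A covector is determined by its values on a spanning set, and the transpose moves
  \<open>h\<close> onto the eigenvectors. The values of \<open>m\<close> there play the part that
  coordinates play for points.\<close>

lemma transpose_eigen_iff:
  fixes h :: "'f::field ^ 'n ^ 'n"
  assumes "vec.span {a, b, c} = UNIV"
    and "h *v a = r *s a" "h *v b = s *s b" "h *v c = t *s c"
  shows "transpose h *v m = k *s m \<longleftrightarrow>
    r * dot m a = k * dot m a \<and> s * dot m b = k * dot m b \<and> t * dot m c = k * dot m c"
proof -
  have "transpose h *v m = k *s m \<longleftrightarrow> (\<forall>v\<in>{a, b, c}. dot (transpose h *v m - k *s m) v = 0)"
    using eq_0_if_dot_eq_0_on_spanning[OF _ assms(1), of "transpose h *v m - k *s m"] by auto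
  then show ?thesis
    by (simp add: dot_diff_left dot_vector_matrix dot_scale_left assms(2-4) dot_scale_right)
qed

text \<open>Comparison of coefficients; the right-hand side has the shape of
  \<open>transpose_eigen_iff\<close>, so that \<open>common_eigenvalue_iff\<close> serves points and
  lines alike.\<close>

lemma eigen_combination3_iff:
  fixes h :: "'f::field ^ 'n ^ 'n"
  assumes "c \<notin> vec.span {a, b}" "b \<notin> vec.span {a}" "a \<noteq> 0"
    and "h *v a = r *s a" "h *v b = s *s b" "h *v c = t *s c"
    and x: "x = \<alpha> *s a + \<beta> *s b + \<gamma> *s c"
  shows "h *v x = k *s x \<longleftrightarrow> r * \<alpha> = k * \<alpha> \<and> s * \<beta> = k * \<beta> \<and> t * \<gamma> = k * \<gamma>"
proof -
  have "h *v x - k *s x = (r * \<alpha> - k * \<alpha>) *s a + (s * \<beta> - k * \<beta>) *s b + (t * \<gamma> - k * \<gamma>) *s c"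
    unfolding x mult_combination3[OF assms(4-6)]
    by (simp add: vec_eq_iff algebra_simps)
  then have "h *v x = k *s x \<longleftrightarrow>
      (r * \<alpha> - k * \<alpha>) *s a + (s * \<beta> - k * \<beta>) *s b + (t * \<gamma> - k * \<gamma>) *s c = 0"
    by (metis eq_iff_diff_eq_0)
  also have "\<dots> \<longleftrightarrow> r * \<alpha> = k * \<alpha> \<and> s * \<beta> = k * \<beta> \<and> t * \<gamma> = k * \<gamma>"
    using linear_combination3_eq_0[OF assms(1-3), of "r * \<alpha> - k * \<alpha>" "s * \<beta> - k * \<beta>" "t * \<gamma> - k * \<gamma>"]
    by auto
  finally show ?thesis .
qed

text \<open>\<open>X\<close>, \<open>Y\<close>, \<open>Z\<close> record which coordinates of the point or line are nonzero.\<close>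

lemma fixes_subspace_basis:
  fixes a b c :: "'f::field ^ 3"
  assumes "c \<notin> vec.span {a, b}" "b \<notin> vec.span {a}" "a \<noteq> 0"
  shows "\<exists>X Y Z. \<forall>g r s t. (if k then g else transpose g) *v a = r *s a \<longrightarrow>
    (if k then g else transpose g) *v b = s *s b \<longrightarrow> (if k then g else transpose g) *v c = t *s c \<longrightarrow>
    (fixes_subspace g x \<longleftrightarrow> (X \<and> Y \<longrightarrow> r = s) \<and> (X \<and> Z \<longrightarrow> r = t) \<and> (Y \<and> Z \<longrightarrow> s = t))"
proof (cases "fst x = k")
  case True
  note UNIV = span_triple_UNIV[OF assms]
  obtain \<alpha> \<beta> \<gamma> where x: "snd x = \<alpha> *s a + \<beta> *s b + \<gamma> *s c"
    using UNIV span_triple[of "snd x" a b c] by auto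
  show ?thesis
    apply (rule exI[of _ "\<alpha> \<noteq> 0"], rule exI[of _ "\<beta> \<noteq> 0"], rule exI[of _ "\<gamma> \<noteq> 0"])
    unfolding fixes_subspace_def has_eigenvector_def True
    using eigen_combination3_iff[OF assms _ _ _ x] by (simp only: common_eigenvalue_iff[symmetric]) blast
next
  case False
  note UNIV = span_triple_UNIV[OF assms]
  let ?m = "snd x"
  \<comment> \<open>Here \<open>x\<close> is of the kind opposite to the basis, so the matrix acting
    on it is the transpose of the one that is diagonal in the basis.\<close>
  have eq: "(if fst x then g else transpose g) = transpose (if k then g else transpose g)"
    for g :: "'f ^ 3 ^ 3"
    using False by auto
  show ?thesis
    apply (rule exI[of _ "dot ?m a \<noteq> 0"], rule exI[of _ "dot ?m b \<noteq> 0"], rule exI[of _ "dot ?m c \<noteq> 0"])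
    unfolding fixes_subspace_def has_eigenvector_def eq
    using transpose_eigen_iff[OF UNIV] by (simp only: common_eigenvalue_iff[symmetric]) blast
qed

section \<open>Irredundant families, and the case of a family containing a basis\<close>

definition irredundant :: "(bool \<times> ('f::field ^ 'n)) set \<Rightarrow> bool" where
  "irredundant S \<longleftrightarrow> (\<forall>x\<in>S. \<exists>g. (\<forall>y\<in>S - {x}. fixes_subspace g y) \<and> \<not> fixes_subspace g x)"

lemma irredundantE:
  assumes "irredundant S" and "x \<in> S"
  obtains g where "\<And>y. y \<in> S \<Longrightarrow> y \<noteq> x \<Longrightarrow> fixes_subspace g y" and "\<not> fixes_subspace g x"
  using assms unfolding irredundant_def by blast

lemma irredundant_nonzero:
  assumes "irredundant S" and "(k, a) \<in> S"
  shows "a \<noteq> 0"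
proof
  assume "a = 0"
  then have "fixes_subspace g (k, a)" for g
    by (simp add: fixes_subspace_def has_eigenvector_def)
  then show False using irredundantE[OF assms] by blast
qed

text \<open>An eigenvector of a matrix stays one after scaling, so a multiple of \<open>a\<close>
  would be redundant. Hence distinct representatives give distinct points or lines.\<close>

lemma irredundant_not_parallel:
  assumes S: "irredundant S" and a: "(k, a) \<in> S" and b: "(k, b) \<in> S" and "a \<noteq> b"
  shows "b \<notin> vec.span {a}"
proof
  assume "b \<in> vec.span {a}"
  then obtain \<alpha> where \<alpha>: "b = \<alpha> *s a" by (auto simp: vec.span_singleton)
  obtain g where g: "\<And>y. y \<in> S \<Longrightarrow> y \<noteq> (k, b) \<Longrightarrow> fixes_subspace g y" "\<not> fixes_subspace g (k, b)"
    using irredundantE[OF S b] by blast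
  have "fixes_subspace g (k, a)" using g(1) a \<open>a \<noteq> b\<close> by auto
  then have "fixes_subspace g (k, b)"
    unfolding fixes_subspace_def has_eigenvector_def \<alpha>
    by (auto simp: vec.scale mult_ac)
  then show False using g by blast
qed

text \<open>For \<open>True\<close> this says that the points are collinear, for
  \<open>False\<close> that the lines are concurrent. In an irredundant family distinct
  \<open>a\<close> and \<open>b\<close> are independent, so a failure of the condition yields a
  basis.\<close>

definition coplanar :: "(bool \<times> ('f::field ^ 'n)) set \<Rightarrow> bool \<Rightarrow> bool" where
  "coplanar S k \<longleftrightarrow> (\<forall>a b c. (k, a) \<in> S \<longrightarrow> (k, b) \<in> S \<longrightarrow> (k, c) \<in> S \<longrightarrow> a \<noteq> b \<longrightarrow> c \<in> vec.span {a, b})"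

lemma obtain_three:
  assumes "3 \<le> card A"
  obtains x y z where "x \<in> A" "y \<in> A" "z \<in> A" "x \<noteq> y" "x \<noteq> z" "y \<noteq> z"
proof -
  obtain T where T: "T \<subseteq> A" "card T = 3"
    using obtain_subset_with_card_n[OF assms] by blast
  then show ?thesis using that by (auto simp: card_3_iff)
qed

text \<open>Three members form a basis. With more than five members, three others remain, each
  imposing a condition on the three eigenvalues, and such conditions cannot be mutually irredundant.
  Keeping \<open>k\<close> arbitrary treats points and lines at once.\<close>

lemma card_le_5_if_not_coplanar:
  fixes S :: "(bool \<times> ('f::field ^ 3)) set"
  assumes S: "irredundant S" "finite S" and "\<not> coplanar S k"
  shows "card S \<le> 5"
proof (rule ccontr)
  assume "\<not> card S \<le> 5"
  obtain a b c where abc: "(k, a) \<in> S" "(k, b) \<in> S" "(k, c) \<in> S" "a \<noteq> b" "c \<notin> vec.span {a, b}"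
    using assms(3) unfolding coplanar_def by blast
  have a: "a \<noteq> 0" using irredundant_nonzero[OF S(1) abc(1)] .
  have b: "b \<notin> vec.span {a}" using irredundant_not_parallel[OF S(1) abc(1,2,4)] .
  let ?T = "{(k, a), (k, b), (k, c)}"
  have "card ?T \<le> 3" by (simp add: card_insert_if)
  then have "3 \<le> card (S - ?T)"
    using \<open>\<not> card S \<le> 5\<close> diff_card_le_card_Diff[of ?T S] by simp
  then obtain x y z where xyz: "x \<in> S - ?T" "y \<in> S - ?T" "z \<in> S - ?T" "x \<noteq> y" "x \<noteq> z" "y \<noteq> z"
    by (rule obtain_three)
  \<comment> \<open>The matrix witnessing that \<open>u\<close> is irredundant fixes all other
    members, hence is diagonal in the basis.\<close>
  have wit: "\<exists>g r s t. fixes_subspace g v \<and> fixes_subspace g w \<and> \<not> fixes_subspace g u \<and>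
     (if k then g else transpose g) *v a = r *s a \<and>
     (if k then g else transpose g) *v b = s *s b \<and> (if k then g else transpose g) *v c = t *s c"
    if u: "u \<in> S - ?T" and "v \<in> S" "w \<in> S" "u \<noteq> v" "u \<noteq> w" for u v w
  proof -
    obtain g where g: "\<And>y. y \<in> S \<Longrightarrow> y \<noteq> u \<Longrightarrow> fixes_subspace g y" "\<not> fixes_subspace g u"
      using irredundantE[OF S(1) DiffD1[OF u]] by blast
    have "fixes_subspace g (k, a)" "fixes_subspace g (k, b)" "fixes_subspace g (k, c)"
      using g(1) abc u by auto
    then show ?thesis
      using g \<open>v \<in> S\<close> \<open>w \<in> S\<close> \<open>u \<noteq> v\<close> \<open>u \<noteq> w\<close> unfolding fixes_subspace_def has_eigenvector_def fst_conv snd_conv by metis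
  qed
  note basis = fixes_subspace_basis[OF abc(5) b a, of k]
  obtain X1 Y1 Z1 where x: "\<And>g r s t. (if k then g else transpose g) *v a = r *s a \<Longrightarrow>
    (if k then g else transpose g) *v b = s *s b \<Longrightarrow> (if k then g else transpose g) *v c = t *s c \<Longrightarrow>
    (fixes_subspace g x \<longleftrightarrow> (X1 \<and> Y1 \<longrightarrow> r = s) \<and> (X1 \<and> Z1 \<longrightarrow> r = t) \<and> (Y1 \<and> Z1 \<longrightarrow> s = t))"
    using basis[of x] by blast
  obtain X2 Y2 Z2 where y: "\<And>g r s t. (if k then g else transpose g) *v a = r *s a \<Longrightarrow>
    (if k then g else transpose g) *v b = s *s b \<Longrightarrow> (if k then g else transpose g) *v c = t *s c \<Longrightarrow>
    (fixes_subspace g y \<longleftrightarrow> (X2 \<and> Y2 \<longrightarrow> r = s) \<and> (X2 \<and> Z2 \<longrightarrow> r = t) \<and> (Y2 \<and> Z2 \<longrightarrow> s = t))"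
    using basis[of y] by blast
  obtain X3 Y3 Z3 where z: "\<And>g r s t. (if k then g else transpose g) *v a = r *s a \<Longrightarrow>
    (if k then g else transpose g) *v b = s *s b \<Longrightarrow> (if k then g else transpose g) *v c = t *s c \<Longrightarrow>
    (fixes_subspace g z \<longleftrightarrow> (X3 \<and> Y3 \<longrightarrow> r = s) \<and> (X3 \<and> Z3 \<longrightarrow> r = t) \<and> (Y3 \<and> Z3 \<longrightarrow> s = t))"
    using basis[of z] by blast
  obtain g1 r1 s1 t1 where 1: "fixes_subspace g1 y" "fixes_subspace g1 z" "\<not> fixes_subspace g1 x"
    and g1: "(if k then g1 else transpose g1) *v a = r1 *s a"
      "(if k then g1 else transpose g1) *v b = s1 *s b" "(if k then g1 else transpose g1) *v c = t1 *s c"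
    using wit[of x y z] xyz by auto
  obtain g2 r2 s2 t2 where 2: "fixes_subspace g2 x" "fixes_subspace g2 z" "\<not> fixes_subspace g2 y"
    and g2: "(if k then g2 else transpose g2) *v a = r2 *s a"
      "(if k then g2 else transpose g2) *v b = s2 *s b" "(if k then g2 else transpose g2) *v c = t2 *s c"
    using wit[of y x z] xyz by auto
  obtain g3 r3 s3 t3 where 3: "fixes_subspace g3 x" "fixes_subspace g3 y" "\<not> fixes_subspace g3 z"
    and g3: "(if k then g3 else transpose g3) *v a = r3 *s a"
      "(if k then g3 else transpose g3) *v b = s3 *s b" "(if k then g3 else transpose g3) *v c = t3 *s c"
    using wit[of z x y] xyz by auto
  \<comment> \<open>No condition is vacuous, and none forces all three eigenvalues to agree, as it
    would imply the other two conditions. So each is a single equality and they are distinct; but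
    two of the equalities among three eigenvalues imply the third.\<close>
  show False
    using 1 2 3 unfolding x[OF g1] y[OF g1] z[OF g1] x[OF g2] y[OF g2] z[OF g2] x[OF g3] y[OF g3] z[OF g3]
    by smt
qed

section \<open>Families of collinear points and concurrent lines\<close>

lemma coplanar_third:
  assumes S: "irredundant S" and "coplanar S k"
    and abc: "(k, a) \<in> S" "(k, b) \<in> S" "(k, c) \<in> S" "a \<noteq> b" "a \<noteq> c" "b \<noteq> c"
  obtains \<alpha> \<beta> where "c = \<alpha> *s a + \<beta> *s b" "\<alpha> \<noteq> 0" "\<beta> \<noteq> 0"
proof -
  obtain \<alpha> \<beta> where c: "c = \<alpha> *s a + \<beta> *s b"
    using assms unfolding coplanar_def span_pair by blast
  \<comment> \<open>A vanishing coefficient would make \<open>c\<close> parallel to \<open>a\<close>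
    or to \<open>b\<close>.\<close>
  have "c \<notin> vec.span {a}" "c \<notin> vec.span {b}"
    using irredundant_not_parallel[OF S] abc by auto
  then have "\<alpha> \<noteq> 0" "\<beta> \<noteq> 0"
    unfolding c by (auto simp: vec.span_scale vec.span_base)
  then show ?thesis using that c by blast
qed

text \<open>The third vector involves both \<open>a\<close> and \<open>b\<close> with nonzero
  coefficients, so comparing coefficients in its eigenvector equation equates all three
  eigenvalues.\<close>

lemma scalar_on_three:
  assumes S: "irredundant S" and "coplanar S k"
    and abc: "(k, a) \<in> S" "(k, b) \<in> S" "(k, c) \<in> S" "a \<noteq> b" "a \<noteq> c" "b \<noteq> c"
    and h: "has_eigenvector h a" "has_eigenvector h b" "has_eigenvector h c"
  obtains s where "h *v a = s *s a" "h *v b = s *s b"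
proof -
  obtain \<alpha> \<beta> where c: "c = \<alpha> *s a + \<beta> *s b" "\<alpha> \<noteq> 0" "\<beta> \<noteq> 0"
    using coplanar_third assms by blast
  obtain r s t where e: "h *v a = r *s a" "h *v b = s *s b" "h *v c = t *s c"
    using h unfolding has_eigenvector_def by blast
  have a: "a \<noteq> 0" using irredundant_nonzero[OF S abc(1)] .
  have b: "b \<notin> vec.span {a}" using irredundant_not_parallel[OF S abc(1,2,4)] .
  have "(\<alpha> * r) *s a + (\<beta> * s) *s b = t *s c"
    using e(3) unfolding c(1) mult_combination2[OF e(1,2)] .
  then have "(\<beta> * (s - t)) *s b = (\<alpha> * (t - r)) *s a"
    unfolding c(1) by (simp add: vec_eq_iff algebra_simps)
  then have "(\<beta> * (s - t)) *s b \<in> vec.span {a}"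
    by (simp add: vec.span_scale vec.span_base)
  then have "\<beta> * (s - t) = 0"
    using b by (simp add: scale_in_span_iff)
  then have "s = t" using c by simp
  with \<open>(\<beta> * (s - t)) *s b = (\<alpha> * (t - r)) *s a\<close> have "t = r"
    using a c by simp
  then show ?thesis using that e \<open>s = t\<close> by blast
qed

text \<open>A fourth vector would lie in the span of \<open>a\<close> and \<open>b\<close>, on which
  any matrix fixing the first three is scalar, so it would be redundant.\<close>

lemma card_le_3_if_coplanar:
  assumes S: "irredundant S" "coplanar S k"
  shows "card {v. (k, v) \<in> S} \<le> 3"
proof (rule ccontr)
  let ?A = "{v. (k, v) \<in> S}"
  assume *: "\<not> card ?A \<le> 3"
  then have "3 \<le> card ?A" by simp
  then obtain a b c where abc: "a \<in> ?A" "b \<in> ?A" "c \<in> ?A" "a \<noteq> b" "a \<noteq> c" "b \<noteq> c"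
    by (rule obtain_three)
  have "card {a, b, c} \<le> 3" by (simp add: card_insert_if)
  then have "\<not> ?A \<subseteq> {a, b, c}"
    using * card_mono[of "{a, b, c}" ?A] by auto
  then obtain d where d: "(k, d) \<in> S" "d \<noteq> a" "d \<noteq> b" "d \<noteq> c" by auto
  obtain \<alpha> \<beta> where d': "d = \<alpha> *s a + \<beta> *s b"
    using S(2) abc d unfolding coplanar_def span_pair by blast
  obtain g where g: "\<And>y. y \<in> S \<Longrightarrow> y \<noteq> (k, d) \<Longrightarrow> fixes_subspace g y" "\<not> fixes_subspace g (k, d)"
    using irredundantE[OF S(1) d(1)] by blast
  let ?h = "if k then g else transpose g"
  have "has_eigenvector ?h a" "has_eigenvector ?h b" "has_eigenvector ?h c"
    using g(1)[of "(k, _)"] abc d unfolding fixes_subspace_def by auto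
  then obtain s where "?h *v a = s *s a" "?h *v b = s *s b"
    using scalar_on_three[OF S] abc by (metis mem_Collect_eq)
  then have "?h *v d = s *s d"
    unfolding d' by (simp only: mult_combination2) (simp add: vec_eq_iff algebra_simps)
  then show False
    using g(2) unfolding fixes_subspace_def has_eigenvector_def by auto
qed

text \<open>Covectors vanishing on a plane are determined by their value at one vector
  \<open>w\<close> outside it; subtracting the multiple of \<open>m\<close> that matches
  \<open>u\<close> at \<open>w\<close> leaves zero.\<close>

lemma parallel_if_annihilate:
  fixes a b m u :: "'f::field ^ 3"
  assumes "b \<notin> vec.span {a}" "a \<noteq> 0" "m \<noteq> 0"
    and "dot m a = 0" "dot m b = 0" "dot u a = 0" "dot u b = 0"
  shows "\<exists>c. u = c *s m"
proof -
  have "vec.dim (vec.span {a, b}) \<le> card {a, b}"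
    by (intro vec.dim_le_card) auto
  also have "\<dots> < 3" by (simp add: card_insert_if)
  finally have "vec.span {a, b} \<noteq> UNIV"
    by (auto simp: card_cart_basis simp del: vec.dim_span)
  then obtain w where w: "w \<notin> vec.span {a, b}" by blast
  note UNIV = span_triple_UNIV[OF w assms(1,2)]
  have mw: "dot m w \<noteq> 0"
    using eq_0_if_dot_eq_0_on_spanning[OF _ UNIV, of m] assms by auto
  have "dot (u - (dot u w / dot m w) *s m) v = 0" if "v \<in> {a, b, w}" for v
    using that assms mw by (auto simp: dot_diff_left dot_scale_left)
  then have "u - (dot u w / dot m w) *s m = 0"
    by (rule eq_0_if_dot_eq_0_on_spanning[OF _ UNIV])
  then show ?thesis by auto
qed

lemma not_coplanar_3_3:
  fixes S :: "(bool \<times> ('f::field ^ 3)) set"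
  assumes S: "irredundant S" and cop: "coplanar S True" "coplanar S False"
    and "3 \<le> card {v. (True, v) \<in> S}" "3 \<le> card {v. (False, v) \<in> S}"
  shows False
proof -
  obtain a b c where "a \<in> {v. (True, v) \<in> S}" "b \<in> {v. (True, v) \<in> S}" "c \<in> {v. (True, v) \<in> S}"
    and abc': "a \<noteq> b" "a \<noteq> c" "b \<noteq> c"
    using assms(4) by (rule obtain_three)
  then have abc: "(True, a) \<in> S" "(True, b) \<in> S" "(True, c) \<in> S" by auto
  obtain l m n where "l \<in> {v. (False, v) \<in> S}" "m \<in> {v. (False, v) \<in> S}" "n \<in> {v. (False, v) \<in> S}"
    and lmn': "l \<noteq> m" "l \<noteq> n" "m \<noteq> n"
    using assms(5) by (rule obtain_three)
  then have lmn: "(False, l) \<in> S" "(False, m) \<in> S" "(False, n) \<in> S" by auto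
  have a: "a \<noteq> 0" using irredundant_nonzero[OF S abc(1)] .
  have b: "b \<notin> vec.span {a}" using irredundant_not_parallel[OF S abc(1,2) abc'(1)] .
  \<comment> \<open>If the line \<open>q\<close> contained both points, every matrix fixing them
    would preserve their span, which is \<open>q\<close> itself, and \<open>q\<close> would be
    redundant.\<close>
  have non0: "dot q a \<noteq> 0 \<or> dot q b \<noteq> 0" if q: "(False, q) \<in> S" for q
  proof (rule ccontr)
    assume *: "\<not> ?thesis"
    obtain g where g: "\<And>y. y \<in> S \<Longrightarrow> y \<noteq> (False, q) \<Longrightarrow> fixes_subspace g y" "\<not> fixes_subspace g (False, q)"
      using irredundantE[OF S q] by blast
    have "fixes_subspace g (True, a)" "fixes_subspace g (True, b)" using g abc by auto
    then obtain r s where e: "g *v a = r *s a" "g *v b = s *s b"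
      unfolding fixes_subspace_def has_eigenvector_def by auto
    have "\<exists>c. transpose g *v q = c *s q"
      using * e by (intro parallel_if_annihilate[OF b a irredundant_nonzero[OF S q]])
        (auto simp: dot_vector_matrix dot_scale_right)
    then show False
      using g(2) unfolding fixes_subspace_def has_eigenvector_def by auto
  qed
  obtain g where g: "\<And>y. y \<in> S \<Longrightarrow> y \<noteq> (False, n) \<Longrightarrow> fixes_subspace g y" "\<not> fixes_subspace g (False, n)"
    using irredundantE[OF S lmn(3)] by blast
  have "has_eigenvector g a" "has_eigenvector g b" "has_eigenvector g c"
    using g(1)[of "(True, _)"] abc unfolding fixes_subspace_def by auto
  then obtain s where s: "g *v a = s *s a" "g *v b = s *s b"
    using scalar_on_three[OF S cop(1) abc abc'] by metis
  \<comment> \<open>Pairing \<open>q\<close> with whichever of \<open>a\<close> and \<open>b\<close>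
    lies off the line compares its eigenvalue with \<open>s\<close>.\<close>
  have eig: "transpose g *v q = s *s q" if q: "(False, q) \<in> S" "q \<noteq> n" for q
  proof -
    obtain k where k: "transpose g *v q = k *s q"
      using g(1)[OF q(1)] q(2) unfolding fixes_subspace_def has_eigenvector_def by auto
    have "k * dot q v = s * dot q v" if "g *v v = s *s v" for v
      using dot_transpose[of g q v] k that by (simp add: dot_scale_left dot_scale_right)
    then have "k = s" using non0[OF q(1)] s by auto
    then show ?thesis using k by simp
  qed
  obtain \<alpha> \<beta> where n: "n = \<alpha> *s l + \<beta> *s m"
    using cop(2) lmn lmn' unfolding coplanar_def span_pair by blast
  have "transpose g *v n = s *s n"
    unfolding n mult_combination2[OF eig[OF lmn(1) lmn'(2)] eig[OF lmn(2) lmn'(3)]]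
    by (simp add: vec_eq_iff algebra_simps)
  then show False
    using g(2) unfolding fixes_subspace_def has_eigenvector_def by auto
qed

text \<open>In the coplanar case there are at most three objects of each kind, and three of both
  kinds are excluded, which leaves at most 3 + 2.\<close>

lemma irredundant_card_le_5:
  fixes S :: "(bool \<times> ('f::field ^ 3)) set"
  assumes S: "irredundant S" "finite S"
  shows "card S \<le> 5"
proof (cases "coplanar S True \<and> coplanar S False")
  case False
  then show ?thesis using card_le_5_if_not_coplanar[OF S] by blast
next
  case True
  let ?A = "\<lambda>k. {v. (k, v) \<in> S}"
  have fin: "finite (?A k)" for k
    by (rule finite_subset[of _ "snd ` S"]) (use S in force)+
  have "S = Pair True ` ?A True \<union> Pair False ` ?A False"
  proof (intro set_eqI)
    fix x show "x \<in> S \<longleftrightarrow> x \<in> Pair True ` ?A True \<union> Pair False ` ?A False"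
      by (cases x; cases "fst x") auto
  qed
  then have "card S \<le> card (Pair True ` ?A True) + card (Pair False ` ?A False)"
    by (metis card_Un_le)
  also have "\<dots> \<le> card (?A True) + card (?A False)"
    by (intro add_mono card_image_le fin)
  also have "\<dots> \<le> 5"
  proof (rule ccontr)
    assume "\<not> ?thesis"
    moreover have "card (?A True) \<le> 3" "card (?A False) \<le> 3"
      using card_le_3_if_coplanar[OF S(1)] True by blast+
    ultimately have "3 \<le> card (?A True)" "3 \<le> card (?A False)" by linarith+
    then show False using not_coplanar_3_3[OF S(1)] True by blast
  qed
  finally show ?thesis .
qed

section \<open>Maximal parabolic subgroups as stabilizers of points and lines\<close>

lemma invertible_mult_eq_0:
  fixes g :: "'f::field ^ 'n ^ 'n"
  assumes "invertible g" "g *v v = 0"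
  shows "v = 0"
  using assms by (metis invertible_def matrix_vector_mul_assoc matrix_vector_mul_lid matrix_vector_mult_0_right)

text \<open>The image of the span is the span of \<open>g *v v\<close>; invertibility rules out the
  eigenvalue 0, so an invariant span is mapped onto itself.\<close>

lemma stabilizer3_span:
  fixes v :: "'f::field ^ 3"
  assumes "v \<noteq> 0"
  shows "stabilizer3 (vec.span {v}) = {g \<in> GL3. fixes_subspace g (True, v)}"
proof -
  have "(\<lambda>v. g *v v) ` vec.span {v} = vec.span {v} \<longleftrightarrow> has_eigenvector g v" if g: "invertible g" for g
  proof -
    have img: "(\<lambda>v. g *v v) ` vec.span {v} = vec.span {g *v v}"
      using vec.linear_span_image[OF matrix_vector_mul_linear_gen[of g], of "{v}"] by simp
    show ?thesis
    proof
      assume "(\<lambda>v. g *v v) ` vec.span {v} = vec.span {v}"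
      then have "g *v v \<in> vec.span {v}"
        unfolding img using vec.span_base by blast
      then show "has_eigenvector g v"
        by (auto simp: vec.span_singleton has_eigenvector_def)
    next
      assume "has_eigenvector g v"
      then obtain c where c: "g *v v = c *s v" unfolding has_eigenvector_def by blast
      have "c \<noteq> 0" using invertible_mult_eq_0[OF g, of v] c assms by auto
      then show "(\<lambda>v. g *v v) ` vec.span {v} = vec.span {v}"
        unfolding img c using vec.span_image_scale[of "{v}" "\<lambda>_. c"] by simp
    qed
  qed
  then show ?thesis
    by (auto simp: stabilizer3_def fixes_subspace_def GL3_def)
qed

text \<open>If \<open>g\<close> preserves the kernel of \<open>m\<close>, then \<open>m\<close>
  composed with \<open>g\<close> also vanishes on it and is a multiple of \<open>m\<close>.
  Conversely the factor is nonzero, so the right inverse of \<open>g\<close> preserves the kernel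
  too and gives preimages.\<close>

lemma stabilizer3_plane:
  fixes a b :: "'f::field ^ 3"
  assumes b: "b \<notin> vec.span {a}" and a: "a \<noteq> 0" and m: "m \<noteq> 0"
    and V: "vec.span {a, b} = {v. dot m v = 0}"
  shows "stabilizer3 (vec.span {a, b}) = {g \<in> GL3. fixes_subspace g (False, m)}"
proof -
  let ?V = "{v. dot m v = 0}"
  have m0: "dot m a = 0" "dot m b = 0"
    using V vec.span_base[of _ "{a, b}"] by blast+
  have "(\<lambda>v. g *v v) ` ?V = ?V \<longleftrightarrow> has_eigenvector (transpose g) m" if g: "invertible g" for g
  proof
    assume "(\<lambda>v. g *v v) ` ?V = ?V"
    then have "dot m (g *v a) = 0" "dot m (g *v b) = 0"
      using m0 by blast+
    then show "has_eigenvector (transpose g) m"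
      unfolding has_eigenvector_def
      by (intro parallel_if_annihilate[OF b a m m0]) (simp_all add: dot_vector_matrix)
  next
    assume "has_eigenvector (transpose g) m"
    then obtain c where c: "transpose g *v m = c *s m" unfolding has_eigenvector_def by blast
    have dot: "dot m (g *v v) = c * dot m v" for v
      using dot_transpose[of g m v] c by (simp add: dot_scale_left)
    obtain h where h: "g ** h = mat 1"
      using g unfolding invertible_def by blast
    have gh: "g *v (h *v v) = v" for v
      by (simp add: matrix_vector_mul_assoc h)
    \<comment> \<open>With \<open>c = 0\<close>, \<open>m\<close> would vanish on the image of
      \<open>g\<close>, which is the whole space.\<close>
    have "c \<noteq> 0"
    proof
      assume "c = 0"
      then have "dot m v = 0" for v
        using dot[of "h *v v"] gh[of v] by simp
      then show False
        using m dot_axis[of m] by (simp add: vec_eq_iff)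
    qed
    have "v \<in> (\<lambda>v. g *v v) ` ?V" if "dot m v = 0" for v
      using dot[of "h *v v"] gh[of v] that \<open>c \<noteq> 0\<close> by (intro image_eqI[of _ _ "h *v v"]) auto
    then show "(\<lambda>v. g *v v) ` ?V = ?V"
      using dot by auto
  qed
  then show ?thesis
    unfolding V by (auto simp: stabilizer3_def fixes_subspace_def GL3_def)
qed

lemma span_pair_eq_kernel:
  fixes a b :: "'f::field ^ 3"
  assumes b: "b \<notin> vec.span {a}" and a: "a \<noteq> 0" and "vec.span {a, b} \<noteq> UNIV"
  obtains m where "m \<noteq> 0" "vec.span {a, b} = {v. dot m v = 0}"
proof -
  obtain w where w: "w \<notin> vec.span {a, b}" using assms(3) by blast
  note UNIV = span_triple_UNIV[OF w b a]
  have "vec.independent {w, b, a}"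
    using w b a by (rule independent_triple)
  \<comment> \<open>The map \<open>f\<close> kills \<open>a\<close> and \<open>b\<close> and sends
    \<open>w\<close> to the first unit vector, so the first row of its matrix is the desired
    covector.\<close>
  then obtain f where f: "Vector_Spaces.linear (*s) (*s) f"
    "\<And>x. x \<in> {w, b, a} \<Longrightarrow> f x = (if x = w then axis 1 1 else (0 :: 'f ^ 3))"
    using vec.linear_independent_extend[of "{w, b, a}" "\<lambda>x. if x = w then axis 1 1 else 0"] by blast
  have "a \<noteq> w" "b \<noteq> w" using w by (auto intro: vec.span_base)
  then have fab: "f a = 0" "f b = 0" "f w = axis 1 1" using f(2) by auto
  let ?m = "row 1 (matrix f)"
  have m: "dot ?m v = f v $ 1" for v
    using matrix_works[OF f(1), of v] by (auto simp: dot_def row_def matrix_vector_mult_def vec_eq_iff)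
  have dots: "dot ?m a = 0" "dot ?m b = 0" "dot ?m w = 1"
    unfolding m fab by (simp_all add: axis_def)
  have "v \<in> vec.span {a, b} \<longleftrightarrow> dot ?m v = 0" for v
  proof
    assume "v \<in> vec.span {a, b}"
    then show "dot ?m v = 0" by (rule dot_eq_0_on_span[rotated]) (use dots in auto)
  next
    assume *: "dot ?m v = 0"
    obtain \<alpha> \<beta> \<gamma> where v: "v = \<alpha> *s a + \<beta> *s b + \<gamma> *s w"
      using UNIV span_triple[of v a b w] by auto
    then have "\<gamma> = 0" using * dots by (simp add: dot_add_right dot_scale_right)
    then show "v \<in> vec.span {a, b}" unfolding span_pair using v by auto
  qed
  moreover have "?m \<noteq> 0" using dots by (metis dot_zero_left zero_neq_one)
  ultimately show ?thesis using that by blast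
qed

text \<open>A nonzero proper subspace has dimension 1 or 2: the first case is encoded by a spanning
  vector, the second by a covector with that kernel.\<close>

lemma maximal_parabolicE:
  assumes "maximal_parabolic P"
  obtains x where "P = {g \<in> GL3. fixes_subspace g x}"
proof -
  obtain V where V: "vec.subspace V" "V \<noteq> {0}" "V \<noteq> UNIV" and P: "P = stabilizer3 V"
    using assms unfolding maximal_parabolic_def by blast
  obtain B where B: "B \<subseteq> V" "vec.independent B" "V \<subseteq> vec.span B" "card B = vec.dim V"
    using vec.basis_exists by blast
  have span: "vec.span B = V"
    using B V(1) by (simp add: vec.span_minimal subset_antisym)
  have fin: "finite B" using B(2) vec.independent_bound_general by blast
  have "vec.dim V \<noteq> 3"
    using V(3) vec.dim_eq_full[of V]
    by (simp add: card_cart_basis vec.dimension_def vec.span_eq_iff[THEN iffD2, OF V(1)] del: vec.span_eq_iff)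
  moreover have "vec.dim V \<le> 3"
    using vec.dim_subset_UNIV[of V] by (simp add: card_cart_basis vec.dimension_def)
  moreover have "card B \<noteq> 0"
    using fin V(2) span by auto
  ultimately have "card B = 1 \<or> card B = 2"
    using B(4) by linarith
  then show ?thesis
  proof
    assume "card B = 1"
    then obtain v where v: "B = {v}" by (rule card_1_singletonE)
    then have "v \<noteq> 0" using B(2) vec.dependent_zero by blast
    then show ?thesis using that P stabilizer3_span[of v] span v by blast
  next
    assume "card B = 2"
    then obtain a b where ab: "B = {b, a}" "a \<noteq> b" by (auto simp: card_2_iff)
    then have b: "b \<notin> vec.span {a}" and a: "a \<noteq> 0"
      using B(2) by (auto simp: vec.independent_insert)
    have sp: "vec.span {a, b} = V" using span ab by (simp add: insert_commute)
    obtain m where "m \<noteq> 0" "vec.span {a, b} = {v. dot m v = 0}"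
      using span_pair_eq_kernel[OF b a] sp V(3) by blast
    then show ?thesis using that P stabilizer3_plane[OF b a] sp by blast
  qed
qed

theorem corollary1p4:
  fixes P :: "nat \<Rightarrow> ('f::field ^ 3 ^ 3) set" and t :: nat
  assumes "infinite (UNIV :: 'f set) \<or> card (UNIV :: 'f set) > 2"
    and "\<And>i. i \<in> {1..t} \<Longrightarrow> maximal_parabolic (P i)"
    and "\<And>i. i \<in> {1..t} \<Longrightarrow> \<not> (GL3 \<inter> (\<Inter>j\<in>{1..t} - {i}. P j) \<subseteq> P i)"
  shows "t \<le> 5"
proof -
  have "\<forall>i\<in>{1..t}. \<exists>x. P i = {g \<in> GL3. fixes_subspace g x}"
    using maximal_parabolicE[OF assms(2)] by metis
  then obtain x where x: "\<And>i. i \<in> {1..t} \<Longrightarrow> P i = {g \<in> GL3. fixes_subspace g (x i)}"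
    by metis
  \<comment> \<open>Equal codes give equal subgroups, and then \<open>P j\<close> already occurs in
    the intersection for \<open>i\<close>. So \<open>t\<close> is the number of codes, and passing
    from the family to its set of codes loses nothing.\<close>
  have inj: "inj_on x {1..t}"
  proof (rule inj_onI, rule ccontr)
    fix i j assume ij: "i \<in> {1..t}" "j \<in> {1..t}" "x i = x j" "i \<noteq> j"
    then have "P i = P j" using x by simp
    then show False using assms(3)[OF ij(1)] ij by blast
  qed
  have "irredundant (x ` {1..t})"
    unfolding irredundant_def
  proof
    fix y assume "y \<in> x ` {1..t}"
    then obtain i where i: "i \<in> {1..t}" "y = x i" by blast
    \<comment> \<open>Since \<open>g\<close> is invertible, lying outside \<open>P i\<close> can
      only mean that \<open>g\<close> does not fix \<open>x i\<close>.\<close>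
    then obtain g where g: "g \<in> GL3" "\<And>j. j \<in> {1..t} - {i} \<Longrightarrow> g \<in> P j" "g \<notin> P i"
      using assms(3)[OF i(1)] by blast
    then show "\<exists>g. (\<forall>z\<in>x ` {1..t} - {y}. fixes_subspace g z) \<and> \<not> fixes_subspace g y"
      using x i by (intro exI[of _ g]) blast
  qed
  then have "card (x ` {1..t}) \<le> 5"
    by (rule irredundant_card_le_5) simp
  then show ?thesis
    using card_image[OF inj] by simp
qed

end
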